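(* Let $\mathcal N$ be a safe high-level Petri net with symbolic unfolding $(U,h)$, and let $C,C_1,\dots,C_n$ be finite configurations of $U$ such that $h(\mathrm{Cut}(C))=h(\mathrm{Cut}(C_i))$ for all $1\le i\le n$. Then $$\mathcal M(C)\subseteq\bigcup_{i=1}^n\mathcal M(C_i)\quad\text{if and only if}\quad \mathrm{constr}(\mathrm{Cut}(C))\Rightarrow\bigvee_{i=1}^n\mathrm{constr}(\mathrm{Cut}(C_i))$$ (the latter meaning that every assignment of colors to the free variables $\{x_p\mid p\in h(\mathrm{Cut}(C))\}$ satisfying the left-hand side satisfies the right-hand side).
   Context: Fix a set $\Sigma$ of colors and a set $V$ of variables. A (high-level) net structure is $N=(P,T,F,G)$ with disjoint sets $P$ (places) and $T$ (transitions), a flow function $F:(P\times V\times T)\cup(T\times V\times P)\to\mathbb N$, and for each $t\in T$ a guard $G(t)$, a predicate with domain $\Sigma$ whose free variables lie in $V(t)=\{v\in V\mid \exists p: F(p,v,t)\ge 1\text{ or }F(t,v,p)\ge1\}$. The preset ${}^\bullet t$ (postset $t^\bullet$) is the multiset over $P\times V$ in which $(p,v)$ has multiplicity $F(p,v,t)$ (resp. $F(t,v,p)$). Write $x\to y$ if $F(x,v,y)\ge1$ for some $v$, and let $\le$, $<$ be the reflexive-transitive and the transitive closure of $\to$. A marking is a multiset over $P\times\Sigma$. A high-level Petri net $\mathcal N=(N,\mathcal M_0)$ is a net structure with a nonempty set $\mathcal M_0$ of initial markings, all of which put the same number of colors on each place. A mode of $t$ is a map $\sigma:V(t)\to\Sigma$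 under which $G(t)$ is true; firing $t$ in mode $\sigma$ from $M\ge{}^\bullet(t,\sigma)$ yields $(M-{}^\bullet(t,\sigma))+(t,\sigma)^\bullet$, where ${}^\bullet(t,\sigma)$, $(t,\sigma)^\bullet$ replace each $(p,v)$ in ${}^\bullet t$, $t^\bullet$ by $(p,\sigma(v))$. The net is safe if every marking reachable from an initial marking puts at most one color on each place. A homomorphism between net structures $(P,T,F,G)$ and $(P',T',F',G')$ (same $\Sigma,V$) is a map $h:P\cup T\to P'\cup T'$ with $h(P)\subseteq P'$, $h(T)\subseteq T'$, and for all $t\in T$: $G(t)=G'(h(t))$, ${}^\bullet h(t)$ equals the multiset $\{(h(p),v)\mid(p,v)\in{}^\bullet t\}$, and likewise for postsets. Between nets it is initial if $\{\{(h(p),c)\mid (p,c)\in M_0\}\mid M_0\in\mathcal M_0\}=\mathcal M_0'$. A high-level occurrence net is a high-level Petri net $O=(B,E,F,G,\mathcal K_0)$ (conditions $B$, events $E$, initial cuts $\mathcal K_0$) that is ordinary ($\sum_v F(x,v,y)\le 1$ for all nodes $x,y$) and satisfies: (i) no event $e$ has $e\sharp e$, where $x\sharp y$ iff there are a condition $b$ and events $e\neq e'$ with $b\to e$, $b\to e'$, $e\le x$, $e'\le y$; (ii) no node $x$ has $x<x$; (iii) $<$ is well-founded; (iv) every condition $b$ either (a) carries exactly one color in every initial cut and has no input event — then set ${}^\bullet b=(\bot,v^b)$ for a fresh variable $v^b$ — or (b) carries no color in any initial cut and there is a unique pair $(e,v)$ with $F(e,v,b)=1$ — then set ${}^\bullet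 b=(e,v)$. Write ${}^\bullet b=(e(b),v(b))$; $B_0$ is the set of conditions of kind (a). For an event $e$ (or the special symbol $\bot$) and a variable $v$, $v_e$ is a fresh indexed variable; for a condition $b$ let $\bar v(b)=v(b)_{e(b)}$. Define $\varphi(\bot)=\bigvee_{K_0\in\mathcal K_0}\bigwedge_{(b,c)\in K_0}(v^b_\bot=c)$, $\varphi_{loc}(e)=G(e)[v\leftarrow v_e]_{v\in V(e)}\wedge\bigwedge_{(b,v)\in{}^\bullet e}(v_e=\bar v(b))$, $\varphi(e)=\varphi(\bot)\wedge\bigwedge_{e'\le e}\varphi_{loc}(e')$. A symbolic branching process of $\mathcal N$ is a pair $(O,h)$ where $O$ is a high-level occurrence net (same $\Sigma,V$) in which every $\varphi(e)$ is satisfiable and $h:O\to\mathcal N$ is an initial homomorphism such that ${}^\bullet e={}^\bullet e'$ and $h(e)=h(e')$ imply $e=e'$. The symbolic unfolding $(U,h)$ is the maximal symbolic branching process w.r.t. the prefix relation (where $(O,h)$ is a prefix of $(O',h')$ if there is an injective initial homomorphism $\phi:O\to O'$ with $h'\circ\phi=h$). A set $X$ of nodes is in color conflict if $\bigwedge_{e\in X\cap E}\varphi(e)\wedge\bigwedge_{b\in X\cap B}\varphi(e(b))$ is unsatisfiable (with $\varphi(e(b))=\varphi(\bot)$ for $b\in B_0$). A configuration is a set $C$ of events that is causally closed, contains no two events in structural conflict, and is not in color conflict. $\mathrm{Cut}(C)=(B_0\cup\{b\mid e(b)\in C\})\setminus\{b\mid \exists e\in C: b\to e\}$; $h(\mathrm{Cut}(C))$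 is the set of labels of its conditions. An instantiation of $C$ is a map $\theta$ from the indexed variables $v_e$ ($e\in C$, $v\in V(e)$) and $v^b_\bot$ ($b\in B_0$) to $\Sigma$ under which $\varphi(e)$ is true for all $e\in C\cup\{\bot\}$; $\mathrm{Inst}(C)$ is their set. $\mathcal M(C)$ is the set of multisets $\{(h(b),\theta(\bar v(b)))\mid b\in\mathrm{Cut}(C)\}$, $\theta\in\mathrm{Inst}(C)$. Constraints: for each place $p$ let $x_p$ be a fresh variable. For a condition $b$, $\psi(b):=\varphi(e(b))\wedge(x_{h(b)}=\bar v(b))$ (with $\varphi(e(b))=\varphi(\bot)$ if $b\in B_0$). For a co-set $B'$ (set of conditions not in color conflict, pairwise neither causally related nor in structural conflict), $\mathrm{constr}(B'):=\exists W:\bigwedge_{b\in B'}\psi(b)$, where $W$ is the set of all indexed variables occurring in the $\varphi(e(b))$, $b\in B'$; its free variables are $\{x_{h(b)}\mid b\in B'\}$.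
   Formalization: The formal theorem additionally assumes that every transition of the net has a nonempty postset; without this the equivalence fails, since constr(Cut(C)) ignores the guards of events in C that produce no conditions. *)

theory Defs
  imports "HOL-Analysis.Infinite_Sum" "HOL-Library.FuncSet"
begin

section \<open>Multisets\<close>

text \<open>
  Presets, postsets and markings need not be finite, so multisets are multiplicity functions.
  Multiplicities live in \<^typ>\<open>enat\<close> so that the image of a multiset is always defined; flow
  functions and initial markings are required to have finite multiplicities.
\<close>

type_synonym 'a mset_fun = "'a \<Rightarrow> enat"

definition mimage :: "('a \<Rightarrow> 'b) \<Rightarrow> 'a mset_fun \<Rightarrow> 'b mset_fun" where
  "mimage f A = (\<lambda>y. \<Sum>\<^sub>\<infinity>x\<in>{x. f x = y}. A x)"

definition mset_of_set :: "'a set \<Rightarrow> 'a mset_fun" where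
  "mset_of_set X = (\<lambda>x. if x \<in> X then 1 else 0)"


section \<open>High-level Petri nets\<close>

text \<open>
  The set of colors is the type \<open>'c\<close>, the set of variables is the type \<open>'v\<close>, and \<open>'n\<close> is a type
  of nodes. A guard is a predicate on assignments of colors to variables.
\<close>

record ('n, 'v, 'c) net_structure =
  places :: "'n set"
  transitions :: "'n set"
  flow :: "'n \<Rightarrow> 'v \<Rightarrow> 'n \<Rightarrow> nat"
  guard :: "'n \<Rightarrow> ('v \<Rightarrow> 'c) \<Rightarrow> bool"

record ('n, 'v, 'c) hlnet = "('n, 'v, 'c) net_structure" +
  initial :: "('n \<times> 'c) mset_fun set"

definition nodes :: "('n, 'v, 'c, 'z) net_structure_scheme \<Rightarrow> 'n set" where
  "nodes N = places N \<union> transitions N"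

definition vars :: "('n, 'v, 'c, 'z) net_structure_scheme \<Rightarrow> 'n \<Rightarrow> 'v set" where
  "vars N t = {v. \<exists>p. flow N p v t \<ge> 1 \<or> flow N t v p \<ge> 1}"

text \<open>
  The flow function is extended by 0 outside its domain
  \<open>(P \<times> V \<times> T) \<union> (T \<times> V \<times> P)\<close>.
\<close>

definition is_net_structure :: "('n, 'v, 'c, 'z) net_structure_scheme \<Rightarrow> bool" where
  "is_net_structure N \<longleftrightarrow>
     places N \<inter> transitions N = {} \<and>
     (\<forall>x v y. flow N x v y \<noteq> 0 \<longrightarrow>
        (x \<in> places N \<and> y \<in> transitions N) \<or> (x \<in> transitions N \<and> y \<in> places N)) \<and>
     (\<forall>t\<in>transitions N. \<forall>\<sigma> \<sigma>'. (\<forall>v\<in>vars N t. \<sigma> v = \<sigma>' v) \<longrightarrow> guard N t \<sigma> = guard N t \<sigma>')"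

definition preset :: "('n, 'v, 'c, 'z) net_structure_scheme \<Rightarrow> 'n \<Rightarrow> ('n \<times> 'v) mset_fun" where
  "preset N t = (\<lambda>(p, v). enat (flow N p v t))"

definition postset :: "('n, 'v, 'c, 'z) net_structure_scheme \<Rightarrow> 'n \<Rightarrow> ('n \<times> 'v) mset_fun" where
  "postset N t = (\<lambda>(p, v). enat (flow N t v p))"

definition arc :: "('n, 'v, 'c, 'z) net_structure_scheme \<Rightarrow> 'n \<Rightarrow> 'n \<Rightarrow> bool" where
  "arc N x y \<longleftrightarrow> (\<exists>v. flow N x v y \<ge> 1)"

abbreviation causal_le :: "('n, 'v, 'c, 'z) net_structure_scheme \<Rightarrow> 'n \<Rightarrow> 'n \<Rightarrow> bool" where
  "causal_le N \<equiv> (arc N)\<^sup>*\<^sup>*"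

abbreviation causal_less :: "('n, 'v, 'c, 'z) net_structure_scheme \<Rightarrow> 'n \<Rightarrow> 'n \<Rightarrow> bool" where
  "causal_less N \<equiv> (arc N)\<^sup>+\<^sup>+"

definition num_colors :: "('n \<times> 'c) mset_fun \<Rightarrow> 'n \<Rightarrow> enat" where
  "num_colors M = mimage fst M"

definition is_hlnet :: "('n, 'v, 'c) hlnet \<Rightarrow> bool" where
  "is_hlnet N \<longleftrightarrow>
     is_net_structure N \<and>
     initial N \<noteq> {} \<and>
     (\<forall>M\<in>initial N. \<forall>p c. M (p, c) \<noteq> \<infinity> \<and> (M (p, c) \<noteq> 0 \<longrightarrow> p \<in> places N)) \<and>
     (\<forall>M\<in>initial N. \<forall>M'\<in>initial N. \<forall>p\<in>places N. num_colors M p = num_colors M' p)"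

text \<open>
  Modes are total maps; their values outside \<^term>\<open>vars N t\<close> influence neither the guard nor
  the multisets below.
\<close>

definition pre_inst ::
  "('n, 'v, 'c, 'z) net_structure_scheme \<Rightarrow> 'n \<Rightarrow> ('v \<Rightarrow> 'c) \<Rightarrow> ('n \<times> 'c) mset_fun" where
  "pre_inst N t \<sigma> = mimage (\<lambda>(p, v). (p, \<sigma> v)) (preset N t)"

definition post_inst ::
  "('n, 'v, 'c, 'z) net_structure_scheme \<Rightarrow> 'n \<Rightarrow> ('v \<Rightarrow> 'c) \<Rightarrow> ('n \<times> 'c) mset_fun" where
  "post_inst N t \<sigma> = mimage (\<lambda>(p, v). (p, \<sigma> v)) (postset N t)"

inductive reachable :: "('n, 'v, 'c) hlnet \<Rightarrow> ('n \<times> 'c) mset_fun \<Rightarrow> bool"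
  for N :: "('n, 'v, 'c) hlnet" where
  init: "M \<in> initial N \<Longrightarrow> reachable N M"
| fire: "reachable N M \<Longrightarrow> t \<in> transitions N \<Longrightarrow> guard N t \<sigma> \<Longrightarrow> (\<forall>x. pre_inst N t \<sigma> x \<le> M x)
    \<Longrightarrow> reachable N (\<lambda>x. (M x - pre_inst N t \<sigma> x) + post_inst N t \<sigma> x)"

definition safe :: "('n, 'v, 'c) hlnet \<Rightarrow> bool" where
  "safe N \<longleftrightarrow> (\<forall>M. reachable N M \<longrightarrow> (\<forall>p\<in>places N. num_colors M p \<le> 1))"


section \<open>Homomorphisms\<close>

definition net_hom ::
  "('n, 'v, 'c, 'z) net_structure_scheme \<Rightarrow> ('m, 'v, 'c, 'y) net_structure_scheme \<Rightarrow> ('n \<Rightarrow> 'm) \<Rightarrow> bool"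
  where
  "net_hom N N' h \<longleftrightarrow>
     h ` places N \<subseteq> places N' \<and> h ` transitions N \<subseteq> transitions N' \<and>
     (\<forall>t\<in>transitions N.
        guard N t = guard N' (h t) \<and>
        preset N' (h t) = mimage (\<lambda>(p, v). (h p, v)) (preset N t) \<and>
        postset N' (h t) = mimage (\<lambda>(p, v). (h p, v)) (postset N t))"

definition initial_hom :: "('n, 'v, 'c) hlnet \<Rightarrow> ('m, 'v, 'c) hlnet \<Rightarrow> ('n \<Rightarrow> 'm) \<Rightarrow> bool" where
  "initial_hom N N' h \<longleftrightarrow>
     net_hom N N' h \<and> (\<lambda>M. mimage (\<lambda>(p, c). (h p, c)) M) ` initial N = initial N'"


section \<open>High-level occurrence nets\<close>

text \<open>
  In an occurrence net, \<^const>\<open>places\<close> are the conditions, \<^const>\<open>transitions\<close> the events and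
  \<^const>\<open>initial\<close> the initial cuts.
\<close>

definition ordinary :: "('n, 'v, 'c, 'z) net_structure_scheme \<Rightarrow> bool" where
  "ordinary N \<longleftrightarrow> (\<forall>x\<in>nodes N. \<forall>y\<in>nodes N. (\<Sum>\<^sub>\<infinity>v. enat (flow N x v y)) \<le> 1)"

definition conflict :: "('n, 'v, 'c, 'z) net_structure_scheme \<Rightarrow> 'n \<Rightarrow> 'n \<Rightarrow> bool" where
  "conflict N x y \<longleftrightarrow>
     (\<exists>b\<in>places N. \<exists>e\<in>transitions N. \<exists>e'\<in>transitions N.
        e \<noteq> e' \<and> arc N b e \<and> arc N b e' \<and> causal_le N e x \<and> causal_le N e' y)"

definition initial_condition :: "('n, 'v, 'c) hlnet \<Rightarrow> 'n \<Rightarrow> bool" where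
  "initial_condition N b \<longleftrightarrow>
     (\<forall>K\<in>initial N. num_colors K b = 1) \<and> \<not> (\<exists>e\<in>transitions N. arc N e b)"

definition produced_condition :: "('n, 'v, 'c) hlnet \<Rightarrow> 'n \<Rightarrow> bool" where
  "produced_condition N b \<longleftrightarrow>
     (\<forall>K\<in>initial N. num_colors K b = 0) \<and>
     (\<exists>!ev. fst ev \<in> transitions N \<and> flow N (fst ev) (snd ev) b = 1)"

definition occurrence_net :: "('n, 'v, 'c) hlnet \<Rightarrow> bool" where
  "occurrence_net N \<longleftrightarrow>
     is_hlnet N \<and>
     ordinary N \<and>
     (\<forall>e\<in>transitions N. \<not> conflict N e e) \<and>
     (\<forall>x\<in>nodes N. \<not> causal_less N x x) \<and>
     wfp (causal_less N) \<and>
     (\<forall>b\<in>places N. initial_condition N b \<or> produced_condition N b)"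

definition initial_conditions :: "('n, 'v, 'c) hlnet \<Rightarrow> 'n set" where
  "initial_conditions N = {b \<in> places N. initial_condition N b}"

text \<open>
  The variables are extended by the fresh variables \<open>v\<^sup>b\<close>, written \<open>Fresh b\<close>. An indexed variable
  \<open>v\<^sub>e\<close> is the pair \<open>(v, e)\<close>, where the index is \<open>Some e\<close> for an event \<open>e\<close> and \<open>None\<close> for the special
  symbol \<open>\<bottom>\<close>. Formulas over the indexed variables are predicates on assignments of colors to them.
\<close>

datatype ('n, 'v) xvar = Var 'v | Fresh 'n

type_synonym ('n, 'v) ivar = "('n, 'v) xvar \<times> 'n option"

type_synonym ('n, 'v, 'c) assignment = "('n, 'v) ivar \<Rightarrow> 'c"

definition cond_preset :: "('n, 'v, 'c) hlnet \<Rightarrow> 'n \<Rightarrow> 'n option \<times> ('n, 'v) xvar" where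
  "cond_preset N b =
     (if b \<in> initial_conditions N then (None, Fresh b)
      else (let ev = (THE ev. fst ev \<in> transitions N \<and> flow N (fst ev) (snd ev) b = 1)
            in (Some (fst ev), Var (snd ev))))"

definition cond_event :: "('n, 'v, 'c) hlnet \<Rightarrow> 'n \<Rightarrow> 'n option" where
  "cond_event N b = fst (cond_preset N b)"

definition cond_var :: "('n, 'v, 'c) hlnet \<Rightarrow> 'n \<Rightarrow> ('n, 'v) xvar" where
  "cond_var N b = snd (cond_preset N b)"

definition cond_ivar :: "('n, 'v, 'c) hlnet \<Rightarrow> 'n \<Rightarrow> ('n, 'v) ivar" where
  "cond_ivar N b = (cond_var N b, cond_event N b)"

definition phi_bot :: "('n, 'v, 'c) hlnet \<Rightarrow> ('n, 'v, 'c) assignment \<Rightarrow> bool" where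
  "phi_bot N \<theta> \<longleftrightarrow> (\<exists>K\<in>initial N. \<forall>b c. K (b, c) \<noteq> 0 \<longrightarrow> \<theta> (Fresh b, None) = c)"

definition phi_loc :: "('n, 'v, 'c) hlnet \<Rightarrow> 'n \<Rightarrow> ('n, 'v, 'c) assignment \<Rightarrow> bool" where
  "phi_loc N e \<theta> \<longleftrightarrow>
     guard N e (\<lambda>v. \<theta> (Var v, Some e)) \<and>
     (\<forall>b v. flow N b v e \<ge> 1 \<longrightarrow> \<theta> (Var v, Some e) = \<theta> (cond_ivar N b))"

fun phi :: "('n, 'v, 'c) hlnet \<Rightarrow> 'n option \<Rightarrow> ('n, 'v, 'c) assignment \<Rightarrow> bool" where
  "phi N None \<theta> \<longleftrightarrow> phi_bot N \<theta>"
| "phi N (Some e) \<theta> \<longleftrightarrow>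
     phi_bot N \<theta> \<and> (\<forall>e'\<in>transitions N. causal_le N e' e \<longrightarrow> phi_loc N e' \<theta>)"


section \<open>Symbolic branching processes and the symbolic unfolding\<close>

definition symbolic_branching_process ::
  "('n, 'v, 'c) hlnet \<Rightarrow> ('u, 'v, 'c) hlnet \<Rightarrow> ('u \<Rightarrow> 'n) \<Rightarrow> bool" where
  "symbolic_branching_process N U h \<longleftrightarrow>
     occurrence_net U \<and>
     (\<forall>e\<in>transitions U. \<exists>\<theta>. phi U (Some e) \<theta>) \<and>
     initial_hom U N h \<and>
     (\<forall>e\<in>transitions U. \<forall>e'\<in>transitions U. preset U e = preset U e' \<and> h e = h e' \<longrightarrow> e = e')"

definition bp_prefix ::
  "('u, 'v, 'c) hlnet \<Rightarrow> ('u \<Rightarrow> 'n) \<Rightarrow> ('w, 'v, 'c) hlnet \<Rightarrow> ('w \<Rightarrow> 'n) \<Rightarrow> bool" where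
  "bp_prefix U h U' h' \<longleftrightarrow>
     (\<exists>f. initial_hom U U' f \<and> inj_on f (nodes U) \<and> (\<forall>x\<in>nodes U. h' (f x) = h x))"

text \<open>
  Maximality ranges over the branching processes whose nodes are taken from the node type of \<open>U\<close>.
  A branching process that is maximal among all branching processes is in particular maximal here.
\<close>

definition symbolic_unfolding ::
  "('n, 'v, 'c) hlnet \<Rightarrow> ('u, 'v, 'c) hlnet \<Rightarrow> ('u \<Rightarrow> 'n) \<Rightarrow> bool" where
  "symbolic_unfolding N U h \<longleftrightarrow>
     symbolic_branching_process N U h \<and>
     (\<forall>(U' :: ('u, 'v, 'c) hlnet) h'.
        symbolic_branching_process N U' h' \<and> bp_prefix U h U' h' \<longrightarrow> bp_prefix U' h' U h)"


section \<open>Configurations, cuts and their markings\<close>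

definition color_conflict :: "('n, 'v, 'c) hlnet \<Rightarrow> 'n set \<Rightarrow> bool" where
  "color_conflict N X \<longleftrightarrow>
     \<not> (\<exists>\<theta>. (\<forall>e\<in>X \<inter> transitions N. phi N (Some e) \<theta>) \<and>
            (\<forall>b\<in>X \<inter> places N. phi N (cond_event N b) \<theta>))"

definition configuration :: "('n, 'v, 'c) hlnet \<Rightarrow> 'n set \<Rightarrow> bool" where
  "configuration N C \<longleftrightarrow>
     C \<subseteq> transitions N \<and>
     (\<forall>e\<in>C. \<forall>e'\<in>transitions N. causal_le N e' e \<longrightarrow> e' \<in> C) \<and>
     (\<forall>e\<in>C. \<forall>e'\<in>C. \<not> conflict N e e') \<and>
     \<not> color_conflict N C"

definition Cut :: "('n, 'v, 'c) hlnet \<Rightarrow> 'n set \<Rightarrow> 'n set" where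
  "Cut N C =
     (initial_conditions N \<union> {b \<in> places N. cond_event N b \<in> Some ` C})
       - {b. \<exists>e\<in>C. arc N b e}"

definition config_ivars :: "('n, 'v, 'c) hlnet \<Rightarrow> 'n set \<Rightarrow> ('n, 'v) ivar set" where
  "config_ivars N C =
     {(Var v, Some e) | v e. e \<in> C \<and> v \<in> vars N e} \<union>
     {(Fresh b, None) | b. b \<in> initial_conditions N}"

definition Inst :: "('n, 'v, 'c) hlnet \<Rightarrow> 'n set \<Rightarrow> ('n, 'v, 'c) assignment set" where
  "Inst N C = {\<theta> \<in> config_ivars N C \<rightarrow>\<^sub>E UNIV. \<forall>e\<in>insert None (Some ` C). phi N e \<theta>}"

definition markings_of ::
  "('u, 'v, 'c) hlnet \<Rightarrow> ('u \<Rightarrow> 'n) \<Rightarrow> 'u set \<Rightarrow> ('n \<times> 'c) mset_fun set" where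
  "markings_of U h C =
     {mimage (\<lambda>b. (h b, \<theta> (cond_ivar U b))) (mset_of_set (Cut U C)) | \<theta>. \<theta> \<in> Inst U C}"


section \<open>Constraints\<close>

text \<open>
  \<open>a p\<close> is the value of the variable \<open>x\<^sub>p\<close>. All indexed variables occurring in the conjunction are
  bound in \<open>constr\<close>, hence the quantification over whole assignments \<open>\<theta>\<close>.
\<close>

definition psi ::
  "('u, 'v, 'c) hlnet \<Rightarrow> ('u \<Rightarrow> 'n) \<Rightarrow> 'u \<Rightarrow> ('u, 'v, 'c) assignment \<Rightarrow> ('n \<Rightarrow> 'c) \<Rightarrow> bool" where
  "psi U h b \<theta> a \<longleftrightarrow> phi U (cond_event U b) \<theta> \<and> a (h b) = \<theta> (cond_ivar U b)"

definition constr ::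
  "('u, 'v, 'c) hlnet \<Rightarrow> ('u \<Rightarrow> 'n) \<Rightarrow> 'u set \<Rightarrow> ('n \<Rightarrow> 'c) \<Rightarrow> bool" where
  "constr U h B a \<longleftrightarrow> (\<exists>\<theta>. \<forall>b\<in>B. psi U h b \<theta> a)"

end

theory Submission
  imports Defs
begin

text \<open>
  Firing the events of a finite configuration \<open>C\<close> one by one, in the modes read off an instantiation
  \<open>\<theta>\<close>, shows that the marking of \<open>Cut(C)\<close> under \<open>\<theta>\<close> is reachable in the original net. By safety,
  \<open>h\<close> is therefore injective on \<open>Cut(C)\<close>, so every marking of \<open>C\<close> is the graph of a map \<open>a\<close> from
  \<open>h(Cut(C))\<close> to colors. Since postsets are nonempty, the conditions of the cut see all events of
  \<open>C\<close>; hence \<open>constr(Cut(C))\<close> holds of \<open>a\<close> iff the graph of \<open>a\<close> is a marking of \<open>C\<close>. As \<open>C\<close> and all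
  \<open>C\<^sub>i\<close> have the same cut labels, the two sides of the theorem speak about the same graphs.
\<close>

section \<open>Images of multiplicity functions\<close>

lemma summable_on_enat: "(f :: 'a \<Rightarrow> enat) summable_on A"
  by (rule nonneg_summable_on_complete) simp

lemma infsum_enat_mono_set:
  fixes f :: "'a \<Rightarrow> enat"
  assumes "A \<subseteq> B"
  shows "infsum f A \<le> infsum f B"
  using assms by (intro infsum_mono_neutral summable_on_enat) auto

text \<open>Infinite sums over \<open>enat\<close> are suprema of finite ones. Finitely many fibres
  are disjoint and add up by induction, and a finite set of points meets only finitely many
  fibres.\<close>

lemma infsum_enat_fibres:
  fixes f :: "'a \<Rightarrow> enat"
  shows "(\<Sum>\<^sub>\<infinity>y\<in>Y. \<Sum>\<^sub>\<infinity>x\<in>{x. g x = y}. f x) = infsum f {x. g x \<in> Y}"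
proof (rule antisym)
  have fin: "(\<Sum>y\<in>G. \<Sum>\<^sub>\<infinity>x\<in>{x. g x = y}. f x) = infsum f {x. g x \<in> G}" if "finite G" for G
    using that
  proof (induction G rule: finite_induct)
    case empty
    then show ?case by simp
  next
    case (insert y G)
    have "{x. g x \<in> insert y G} = {x. g x = y} \<union> {x. g x \<in> G}" by auto
    moreover have "infsum f ({x. g x = y} \<union> {x. g x \<in> G})
        = infsum f {x. g x = y} + infsum f {x. g x \<in> G}"
      using insert.hyps by (intro infsum_Un_disjoint summable_on_enat) auto
    ultimately show ?case using insert by simp
  qed
  show "(\<Sum>\<^sub>\<infinity>y\<in>Y. \<Sum>\<^sub>\<infinity>x\<in>{x. g x = y}. f x) \<le> infsum f {x. g x \<in> Y}"
    by (subst nonneg_infsum_complete) (auto intro!: SUP_least infsum_enat_mono_set simp: fin)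
  show "infsum f {x. g x \<in> Y} \<le> (\<Sum>\<^sub>\<infinity>y\<in>Y. \<Sum>\<^sub>\<infinity>x\<in>{x. g x = y}. f x)"
  proof (subst (1) nonneg_infsum_complete, simp, rule SUP_least)
    fix F assume "F \<in> {F. finite F \<and> F \<subseteq> {x. g x \<in> Y}}"
    then have F: "finite F" "g ` F \<subseteq> Y" by auto
    have "sum f F = infsum f F" using F by simp
    also have "\<dots> \<le> infsum f {x. g x \<in> g ` F}" by (rule infsum_enat_mono_set) auto
    also have "\<dots> = (\<Sum>\<^sub>\<infinity>y\<in>g ` F. \<Sum>\<^sub>\<infinity>x\<in>{x. g x = y}. f x)" using fin[of "g ` F"] F by simp
    also have "\<dots> \<le> (\<Sum>\<^sub>\<infinity>y\<in>Y. \<Sum>\<^sub>\<infinity>x\<in>{x. g x = y}. f x)" using F by (intro infsum_enat_mono_set)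
    finally show "sum f F \<le> (\<Sum>\<^sub>\<infinity>y\<in>Y. \<Sum>\<^sub>\<infinity>x\<in>{x. g x = y}. f x)" .
  qed
qed

lemma mimage_mimage: "mimage f (mimage g A) = mimage (\<lambda>x. f (g x)) A"
  using infsum_enat_fibres[where Y = "{y. f y = _}" and g = g and f = A]
  by (auto simp: mimage_def)

lemma mimage_cong:
  assumes "\<And>x. A x \<noteq> 0 \<Longrightarrow> f x = g x"
  shows "mimage f A = mimage g A"
  unfolding mimage_def using assms by (intro ext infsum_cong_neutral) fastforce+

lemma mimage_neq_0D:
  assumes "mimage f A y \<noteq> 0"
  obtains x where "f x = y" "A x \<noteq> 0"
  using assms infsum_0[of "{x. f x = y}" A] unfolding mimage_def by blast

lemma sum_le_mimage:
  assumes "finite F" "\<And>x. x \<in> F \<Longrightarrow> f x = y"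
  shows "sum A F \<le> mimage f A y"
  using assms infsum_enat_mono_set[of F "{x. f x = y}" A] unfolding mimage_def by auto

lemma le_mimage: "A x \<le> mimage f A (f x)"
  using sum_le_mimage[of "{x}" f "f x" A] by simp

lemma mimage_mset_of_set_inj:
  assumes "inj_on f X"
  shows "mimage f (mset_of_set X) = mset_of_set (f ` X)"
proof
  fix y
  show "mimage f (mset_of_set X) y = mset_of_set (f ` X) y"
  proof (cases "y \<in> f ` X")
    case True
    then obtain x where x: "x \<in> X" "y = f x" by auto
    have "mimage f (mset_of_set X) y = infsum (mset_of_set X) {x}"
      unfolding mimage_def using x assms
      by (intro infsum_cong_neutral) (auto simp: mset_of_set_def inj_on_def)
    then show ?thesis using x by (simp add: mset_of_set_def)
  next
    case False
    then have "mimage f (mset_of_set X) y = 0"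
      unfolding mimage_def by (intro infsum_0) (auto simp: mset_of_set_def)
    then show ?thesis using False by (simp add: mset_of_set_def)
  qed
qed

lemma mimage_mset_of_set_Un:
  assumes "X \<inter> Y = {}"
  shows "mimage f (mset_of_set (X \<union> Y)) y = mimage f (mset_of_set X) y + mimage f (mset_of_set Y) y"
proof -
  have "infsum (mset_of_set (X \<union> Y)) {x. f x = y}
      = infsum (\<lambda>x. mset_of_set X x + mset_of_set Y x) {x. f x = y}"
    using assms by (intro infsum_cong) (auto simp: mset_of_set_def)
  then show ?thesis
    unfolding mimage_def by (simp add: infsum_add summable_on_enat)
qed

text \<open>The hypotheses make \<open>A\<close> the indicator of the graph of a function with
  domain \<open>X\<close>, so \<open>fst\<close> is injective on the support and maps it onto
  \<open>X\<close>. Presets, postsets and initial cuts all have this shape.\<close>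

lemma mimage_functional_relation:
  assumes "\<And>x y. A (x, y) \<noteq> 0 \<Longrightarrow> A (x, y) = 1 \<and> x \<in> X \<and> f (x, y) = g x"
    and "\<And>x y y'. A (x, y) \<noteq> 0 \<Longrightarrow> A (x, y') \<noteq> 0 \<Longrightarrow> y = y'"
    and "\<And>x. x \<in> X \<Longrightarrow> \<exists>y. A (x, y) \<noteq> 0"
  shows "mimage f A = mimage g (mset_of_set X)"
proof -
  let ?R = "{z. A z \<noteq> 0}"
  have A: "A = mset_of_set ?R"
    using assms(1) by (fastforce simp: mset_of_set_def)
  have "inj_on fst ?R" using assms(2) by (auto simp: inj_on_def)
  then have "mimage fst A = mset_of_set (fst ` ?R)"
    by (subst A) (rule mimage_mset_of_set_inj)
  also have "fst ` ?R = X" using assms(1,3) by (force simp: image_iff)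
  finally have "mimage g (mset_of_set X) = mimage (\<lambda>z. g (fst z)) A"
    by (metis mimage_mimage)
  also have "\<dots> = mimage f A" using assms(1) by (intro mimage_cong) (auto split: prod.splits)
  finally show ?thesis ..
qed


section \<open>Occurrence nets\<close>

locale occ_net =
  fixes U :: "('u, 'v, 'c) hlnet"
  assumes occ: "occurrence_net U"
begin

lemma net_structure: "is_net_structure U"
  using occ by (simp add: occurrence_net_def is_hlnet_def)

lemma arc_cases:
  assumes "arc U x y"
  shows "x \<in> places U \<and> y \<in> transitions U \<or> x \<in> transitions U \<and> y \<in> places U"
  using assms net_structure unfolding is_net_structure_def arc_def
  by (metis not_one_le_zero)

lemma place_not_transition: "x \<in> places U \<Longrightarrow> x \<notin> transitions U"
  using net_structure by (auto simp: is_net_structure_def)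

lemma causal_less_irrefl: "\<not> causal_less U x x"
  using occ unfolding occurrence_net_def by (metis wfp_imp_irreflp irreflpD)

text \<open>Ordinariness in finite form: a singleton \<open>V\<close> bounds the weight of an arc by
  one, and a two-element \<open>V\<close> makes the variable on an arc unique. Outside the nodes the
  flow vanishes, so no membership has to be assumed.\<close>

lemma flow_sum_le_1:
  assumes "finite V"
  shows "(\<Sum>v\<in>V. flow U x v y) \<le> 1"
proof (cases "\<exists>v. flow U x v y \<noteq> 0")
  case False
  then show ?thesis by simp
next
  case True
  then have "arc U x y" by (auto simp: arc_def Suc_le_eq)
  then have "x \<in> nodes U" "y \<in> nodes U" using arc_cases by (auto simp: nodes_def)
  then have "(\<Sum>\<^sub>\<infinity>v. enat (flow U x v y)) \<le> 1"
    using occ by (auto simp: occurrence_net_def ordinary_def)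
  moreover have "(\<Sum>v\<in>V. enat (flow U x v y)) \<le> (\<Sum>\<^sub>\<infinity>v. enat (flow U x v y))"
    using infsum_enat_mono_set[of V UNIV "\<lambda>v. enat (flow U x v y)"] assms by simp
  ultimately have "(\<Sum>v\<in>V. enat (flow U x v y)) \<le> 1" by simp
  moreover have "(\<Sum>v\<in>V. enat (flow U x v y)) = enat (\<Sum>v\<in>V. flow U x v y)"
    using assms by (induction V rule: finite_induct) (auto simp: zero_enat_def)
  ultimately show ?thesis by (simp add: one_enat_def)
qed

lemma flow_eq_1: "flow U x v y \<noteq> 0 \<Longrightarrow> flow U x v y = 1"
  using flow_sum_le_1[of "{v}" x y] by simp

lemma flow_functional: "flow U x v y \<noteq> 0 \<Longrightarrow> flow U x v' y \<noteq> 0 \<Longrightarrow> v = v'"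
  using flow_sum_le_1[of "{v, v'}" x y] by (cases "v = v'") auto

text \<open>A color on \<open>b\<close> makes its color count nonzero, which excludes the produced
  kind.\<close>

lemma initial_condition_marked:
  assumes "K \<in> initial U" "K (b, c) \<noteq> 0"
  shows "b \<in> initial_conditions U"
proof -
  have b: "b \<in> places U"
    using assms occ by (auto simp: occurrence_net_def is_hlnet_def)
  have "num_colors K b \<noteq> 0"
    using le_mimage[of K "(b, c)" fst] assms by (auto simp: num_colors_def)
  then show ?thesis
    using b occ assms by (auto simp: occurrence_net_def initial_conditions_def produced_condition_def)
qed

lemma cond_ivar_initial: "b \<in> initial_conditions U \<Longrightarrow> cond_ivar U b = (Fresh b, None)"
  by (simp add: cond_ivar_def cond_var_def cond_event_def cond_preset_def)

lemma cond_event_initial: "b \<in> initial_conditions U \<Longrightarrow> cond_event U b = None"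
  by (simp add: cond_event_def cond_preset_def)

lemma initial_condition_no_input:
  "b \<in> initial_conditions U \<Longrightarrow> \<not> arc U e b"
  using arc_cases[of e b] place_not_transition
  by (auto simp: initial_conditions_def initial_condition_def)

text \<open>An input arc excludes the initial kind, so the uniqueness in
  \<open>produced_condition\<close> evaluates the description operator in
  \<open>cond_preset\<close>.\<close>

lemma cond_ivar_produced:
  assumes "flow U e v b \<noteq> 0" "b \<in> places U"
  shows "cond_ivar U b = (Var v, Some e)"
proof -
  have arc: "arc U e b" using assms by (auto simp: arc_def Suc_le_eq)
  then have e: "e \<in> transitions U" using arc_cases place_not_transition assms by blast
  have b: "b \<notin> initial_conditions U" using initial_condition_no_input arc by blast
  then have "\<exists>!ev. fst ev \<in> transitions U \<and> flow U (fst ev) (snd ev) b = 1"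
    using occ assms
    by (auto simp: occurrence_net_def initial_conditions_def produced_condition_def)
  then have "(THE ev. fst ev \<in> transitions U \<and> flow U (fst ev) (snd ev) b = 1) = (e, v)"
    using e flow_eq_1[OF assms(1)] by (intro the1_equality) auto
  then show ?thesis using b
    by (simp add: cond_ivar_def cond_var_def cond_event_def cond_preset_def)
qed

lemma cond_event_produced:
  assumes "arc U e b" "b \<in> places U"
  shows "cond_event U b = Some e"
  using assms cond_ivar_produced by (fastforce simp: arc_def cond_ivar_def Suc_le_eq)

lemma place_cases:
  assumes "b \<in> places U"
  obtains (initial) "b \<in> initial_conditions U"
  | (produced) e v where "e \<in> transitions U" "flow U e v b \<noteq> 0"
  using assms occ that
  by (fastforce simp: occurrence_net_def initial_conditions_def produced_condition_def)

lemma cond_event_eq_Some: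
  assumes "b \<in> places U" "cond_event U b = Some e"
  obtains v where "e \<in> transitions U" "flow U e v b \<noteq> 0"
  using assms(1)
proof (cases rule: place_cases)
  case initial
  then show ?thesis using assms cond_event_initial by simp
next
  case (produced e' v)
  then have "e' = e" using cond_ivar_produced assms by (fastforce simp: cond_ivar_def)
  then show ?thesis using produced that by blast
qed

section \<open>Formulas of a configuration and the variables they read\<close>

lemma Cut_subset_places: "Cut U C \<subseteq> places U"
  by (auto simp: Cut_def initial_conditions_def)

text \<open>The causal pasts of the events of \<open>C\<close> together make up \<open>C\<close>, by
  causal closure; \<open>phi_bot\<close> comes from the index \<open>None\<close>.\<close>

lemma phi_iff:
  assumes "configuration U C"
  shows "(\<forall>e\<in>insert None (Some ` C). phi U e \<theta>) \<longleftrightarrow> phi_bot U \<theta> \<and> (\<forall>e\<in>C. phi_loc U e \<theta>)"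
  using assms unfolding configuration_def by auto

lemma cond_ivar_in_config_ivars:
  assumes "b \<in> places U" "b \<in> initial_conditions U \<or> cond_event U b \<in> Some ` C"
  shows "cond_ivar U b \<in> config_ivars U C"
  using assms(1)
proof (cases rule: place_cases)
  case initial
  then show ?thesis by (simp add: cond_ivar_initial config_ivars_def)
next
  case (produced e v)
  then have ce: "cond_ivar U b = (Var v, Some e)" using cond_ivar_produced assms by blast
  have "b \<notin> initial_conditions U"
    using produced initial_condition_no_input by (auto simp: arc_def Suc_le_eq)
  then have "e \<in> C" using ce assms by (auto simp: cond_ivar_def)
  moreover have "v \<in> vars U e" using produced by (auto simp: vars_def Suc_le_eq)
  ultimately show ?thesis using ce by (auto simp: config_ivars_def)
qed

lemma Cut_cond_ivar: "b \<in> Cut U C \<Longrightarrow> cond_ivar U b \<in> config_ivars U C"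
  by (intro cond_ivar_in_config_ivars) (auto simp: Cut_def initial_conditions_def)

text \<open>The producer of an input condition of \<open>e\<close> lies below \<open>e\<close>,
  hence in \<open>C\<close> by causal closure.\<close>

lemma preset_cond:
  assumes "configuration U C" "e \<in> C" "arc U b e"
  shows "b \<in> places U" "b \<in> initial_conditions U \<or> cond_event U b \<in> Some ` C"
proof -
  have e: "e \<in> transitions U" using assms by (auto simp: configuration_def)
  then show b: "b \<in> places U" using arc_cases assms place_not_transition by blast
  from b show "b \<in> initial_conditions U \<or> cond_event U b \<in> Some ` C"
  proof (cases rule: place_cases)
    case (produced e' v)
    then have arc: "arc U e' b" by (auto simp: arc_def Suc_le_eq)
    then have "causal_le U e' e" using assms by (meson converse_rtranclp_into_rtranclp r_into_rtranclp)
    then have "e' \<in> C" using assms produced by (auto simp: configuration_def)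
    then show ?thesis using cond_event_produced arc b by auto
  qed auto
qed

lemma phi_bot_cong:
  assumes "\<And>x. x \<in> config_ivars U C \<Longrightarrow> \<theta> x = \<theta>' x"
  shows "phi_bot U \<theta> \<longleftrightarrow> phi_bot U \<theta>'"
proof -
  have "\<theta> (Fresh b, None) = \<theta>' (Fresh b, None)" if "K \<in> initial U" "K (b, c) \<noteq> 0" for K b c
    using assms initial_condition_marked[OF that] by (auto simp: config_ivars_def)
  then show ?thesis unfolding phi_bot_def by (metis (no_types, lifting))
qed

text \<open>The guard reads only variables of \<open>e\<close>, and the remaining variables belong
  to input conditions of \<open>e\<close>, which are initial or produced inside
  \<open>C\<close>.\<close>

lemma phi_loc_cong:
  assumes "configuration U C" "e \<in> C" "\<And>x. x \<in> config_ivars U C \<Longrightarrow> \<theta> x = \<theta>' x"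
  shows "phi_loc U e \<theta> \<longleftrightarrow> phi_loc U e \<theta>'"
proof -
  have e: "e \<in> transitions U" using assms by (auto simp: configuration_def)
  have vars: "\<theta> (Var v, Some e) = \<theta>' (Var v, Some e)" if "v \<in> vars U e" for v
    using that assms by (auto simp: config_ivars_def)
  then have "guard U e (\<lambda>v. \<theta> (Var v, Some e)) = guard U e (\<lambda>v. \<theta>' (Var v, Some e))"
    using net_structure e by (simp add: is_net_structure_def)
  moreover have "\<theta> (Var v, Some e) = \<theta>' (Var v, Some e) \<and> \<theta> (cond_ivar U b) = \<theta>' (cond_ivar U b)"
    if "flow U b v e \<ge> 1" for b v
  proof
    show "\<theta> (Var v, Some e) = \<theta>' (Var v, Some e)" using that by (intro vars) (auto simp: vars_def)
    have "arc U b e" using that by (auto simp: arc_def)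
    then show "\<theta> (cond_ivar U b) = \<theta>' (cond_ivar U b)"
      using preset_cond assms cond_ivar_in_config_ivars by blast
  qed
  ultimately show ?thesis unfolding phi_loc_def by metis
qed

text \<open>Bridges the total assignments quantified in \<open>constr\<close> and the extensional
  ones collected in \<open>Inst\<close>.\<close>

lemma restrict_in_Inst:
  assumes "configuration U C" "phi_bot U \<theta>" "\<forall>e\<in>C. phi_loc U e \<theta>"
  shows "restrict \<theta> (config_ivars U C) \<in> Inst U C"
proof -
  let ?\<theta> = "restrict \<theta> (config_ivars U C)"
  have "phi_bot U ?\<theta>" using phi_bot_cong[of C \<theta> ?\<theta>] assms by simp
  moreover have "phi_loc U e ?\<theta>" if "e \<in> C" for e
    using phi_loc_cong[of C e \<theta> ?\<theta>] assms that by simp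
  ultimately show ?thesis using phi_iff[OF assms(1)] by (auto simp: Inst_def)
qed

section \<open>Causally maximal events\<close>

lemma maximal_event:
  assumes "finite C" "C \<noteq> {}"
  shows "\<exists>e\<in>C. \<forall>e'\<in>C. \<not> causal_less U e e'"
proof -
  have "asymp_on C (causal_less U)" 
    by (rule asymp_onI) (use causal_less_irrefl tranclp_trans in metis)
  moreover have "transp_on C (causal_less U)" by (rule transp_onI) (rule tranclp_trans)
  ultimately obtain e where "e \<in> C" "\<forall>x\<in>C. x \<noteq> e \<longrightarrow> \<not> causal_less U e x"
    using Finite_Set.bex_max_element[OF assms(1) _ _ assms(2)] by blast
  then show ?thesis using causal_less_irrefl by metis
qed

text \<open>Maximality among the events of \<open>C\<close> above \<open>e\<close> is maximality in
  all of \<open>C\<close>, because anything above the chosen event is again above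
  \<open>e\<close>.\<close>

lemma maximal_event_above:
  assumes "finite C" "e \<in> C"
  shows "\<exists>e'\<in>C. causal_le U e e' \<and> (\<forall>e''\<in>C. \<not> causal_less U e' e'')"
proof -
  let ?D = "{x \<in> C. causal_le U e x}"
  have "finite ?D" "?D \<noteq> {}" using assms by auto
  then obtain e' where e': "e' \<in> ?D" "\<forall>e''\<in>?D. \<not> causal_less U e' e''"
    using maximal_event by blast
  have "\<not> causal_less U e' e''" if "e'' \<in> C" for e''
  proof
    assume less: "causal_less U e' e''"
    have "causal_le U e e'" using e'(1) by simp
    then have "causal_le U e e''" using tranclp_into_rtranclp[OF less] by (rule rtranclp_trans)
    then show False using e'(2) less that by blast
  qed
  then show ?thesis using e'(1) by blast
qed

text \<open>An event of \<open>C\<close> consuming \<open>b\<close> would lie strictly above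
  \<open>e\<close>.\<close>

lemma postset_in_Cut:
  assumes "C \<subseteq> transitions U" "e \<in> C" "\<And>e'. e' \<in> C \<Longrightarrow> \<not> causal_less U e e'" "arc U e b"
  shows "b \<in> Cut U C"
proof -
  have b: "b \<in> places U" using assms arc_cases place_not_transition by blast
  moreover have "\<not> arc U b e'" if "e' \<in> C" for e'
    using assms(3)[OF that] assms(4) by (meson tranclp.simps)
  ultimately show ?thesis using cond_event_produced[OF assms(4)] assms(2) by (auto simp: Cut_def)
qed

end


section \<open>Reachability of the markings of a configuration\<close>

locale branching_process = occ_net U
  for N :: "('n, 'v, 'c) hlnet" and U :: "('u, 'v, 'c) hlnet" and h :: "'u \<Rightarrow> 'n" +
  assumes ini_hom: "initial_hom U N h"
begin

text \<open>Allows any set of conditions, so that presets, postsets and cuts can be added and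
  subtracted in the same terms.\<close>

definition marking :: "('u, 'v, 'c) assignment \<Rightarrow> 'u set \<Rightarrow> ('n \<times> 'c) mset_fun" where
  "marking \<theta> B = mimage (\<lambda>b. (h b, \<theta> (cond_ivar U b))) (mset_of_set B)"

lemma hom: "net_hom U N h"
  using ini_hom by (simp add: initial_hom_def)

text \<open>The homomorphism transports the preset of \<open>e\<close> to that of
  \<open>h e\<close>, and \<open>phi_loc\<close> equates each variable of \<open>e\<close> on an
  input arc with the variable of that condition. Hence the mode consumes exactly the colors the
  conditions carry under \<theta>.\<close>

lemma pre_inst_eq:
  assumes "e \<in> transitions U" "phi_loc U e \<theta>"
  shows "pre_inst N (h e) (\<lambda>v. \<theta> (Var v, Some e)) = marking \<theta> {b. arc U b e}"
proof -
  let ?\<sigma> = "\<lambda>v. \<theta> (Var v, Some e)"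
  have "pre_inst N (h e) ?\<sigma> = mimage (\<lambda>(b, v). (h b, ?\<sigma> v)) (preset U e)"
    using hom assms by (simp add: pre_inst_def net_hom_def mimage_mimage case_prod_unfold)
  also have "\<dots> = marking \<theta> {b. arc U b e}"
    unfolding marking_def
  proof (rule mimage_functional_relation)
    fix b v assume "preset U e (b, v) \<noteq> 0"
    then have "flow U b v e \<noteq> 0" by (simp add: preset_def zero_enat_def)
    moreover from this have "arc U b e" by (auto simp: arc_def Suc_le_eq)
    ultimately show "preset U e (b, v) = 1 \<and> b \<in> {b. arc U b e} \<and>
        (case (b, v) of (b, v) \<Rightarrow> (h b, ?\<sigma> v)) = (h b, \<theta> (cond_ivar U b))"
      using assms flow_eq_1[of b v e]
      by (auto simp: preset_def one_enat_def phi_loc_def Suc_le_eq)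
  next
    fix b v v' assume "preset U e (b, v) \<noteq> 0" "preset U e (b, v') \<noteq> 0"
    then show "v = v'" using flow_functional[of b v e v'] by (simp add: preset_def zero_enat_def)
  next
    fix b assume "b \<in> {b. arc U b e}"
    then show "\<exists>v. preset U e (b, v) \<noteq> 0"
      by (auto simp: preset_def arc_def zero_enat_def Suc_le_eq)
  qed
  finally show ?thesis .
qed

text \<open>The variable of an output condition of \<open>e\<close> is itself a variable indexed by
  \<open>e\<close>, so the colors agree for every \<theta>.\<close>

lemma post_inst_eq:
  assumes "e \<in> transitions U"
  shows "post_inst N (h e) (\<lambda>v. \<theta> (Var v, Some e)) = marking \<theta> {b. arc U e b}"
proof -
  let ?\<sigma> = "\<lambda>v. \<theta> (Var v, Some e)"
  have "post_inst N (h e) ?\<sigma> = mimage (\<lambda>(b, v). (h b, ?\<sigma> v)) (postset U e)"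
    using hom assms by (simp add: post_inst_def net_hom_def mimage_mimage case_prod_unfold)
  also have "\<dots> = marking \<theta> {b. arc U e b}"
    unfolding marking_def
  proof (rule mimage_functional_relation)
    fix b v assume "postset U e (b, v) \<noteq> 0"
    then have f: "flow U e v b \<noteq> 0" by (simp add: postset_def zero_enat_def)
    then have arc: "arc U e b" by (auto simp: arc_def Suc_le_eq)
    then have "b \<in> places U" using arc_cases assms place_not_transition by blast
    then show "postset U e (b, v) = 1 \<and> b \<in> {b. arc U e b} \<and>
        (case (b, v) of (b, v) \<Rightarrow> (h b, ?\<sigma> v)) = (h b, \<theta> (cond_ivar U b))"
      using f arc flow_eq_1[of e v b] cond_ivar_produced[of e v b]
      by (auto simp: postset_def one_enat_def)
  next
    fix b v v' assume "postset U e (b, v) \<noteq> 0" "postset U e (b, v') \<noteq> 0"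
    then show "v = v'" using flow_functional[of e v b v'] by (simp add: postset_def zero_enat_def)
  next
    fix b assume "b \<in> {b. arc U e b}"
    then show "\<exists>v. postset U e (b, v) \<noteq> 0"
      by (auto simp: postset_def arc_def zero_enat_def Suc_le_eq)
  qed
  finally show ?thesis .
qed

text \<open>The initial cut \<open>K\<close> chosen by \<open>phi_bot\<close> puts one token on each
  initial condition, with the color given by \<theta>; its image under \<open>h\<close> is initial
  in \<open>N\<close>.\<close>

lemma marking_initial:
  assumes "phi_bot U \<theta>"
  shows "marking \<theta> (initial_conditions U) \<in> initial N"
proof -
  obtain K where K: "K \<in> initial U" "\<And>b c. K (b, c) \<noteq> 0 \<Longrightarrow> \<theta> (Fresh b, None) = c"
    using assms by (auto simp: phi_bot_def)
  have num: "num_colors K b = 1" if "b \<in> initial_conditions U" for b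
    using that K by (auto simp: initial_conditions_def initial_condition_def)
  have "mimage (\<lambda>(b, c). (h b, c)) K = marking \<theta> (initial_conditions U)"
    unfolding marking_def
  proof (rule mimage_functional_relation)
    fix b c assume bc: "K (b, c) \<noteq> 0"
    then have b: "b \<in> initial_conditions U" using initial_condition_marked K by blast
    have "K (b, c) \<le> 1"
      using le_mimage[of K "(b, c)" fst] num[OF b] by (simp add: num_colors_def)
    then have "K (b, c) = 1" using bc by (metis antisym ileI1 one_eSuc not_gr_zero)
    then show "K (b, c) = 1 \<and> b \<in> initial_conditions U \<and>
        (case (b, c) of (b, c) \<Rightarrow> (h b, c)) = (h b, \<theta> (cond_ivar U b))"
      using b K(2)[OF bc] cond_ivar_initial by simp
  next
    fix b c c' assume "K (b, c) \<noteq> 0" "K (b, c') \<noteq> 0"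
    then show "c = c'" using K(2) by blast
  next
    fix b assume "b \<in> initial_conditions U"
    then have "mimage fst K b \<noteq> 0" using num by (simp add: num_colors_def)
    then show "\<exists>c. K (b, c) \<noteq> 0" by (elim mimage_neq_0D) auto
  qed
  then show ?thesis using ini_hom K(1) unfolding initial_hom_def by (metis imageI)
qed

text \<open>Cancelling a subtraction in \<open>enat\<close> fails at infinity; safety keeps all
  multiplicities of reachable markings finite.\<close>

lemma reachable_finite:
  assumes "safe N" "B \<subseteq> places U" "reachable N (marking \<theta> B)"
  shows "marking \<theta> B x \<noteq> \<infinity>"
proof
  assume inf: "marking \<theta> B x = \<infinity>"
  then have "marking \<theta> B x \<noteq> 0" by simp
  then obtain b where "mset_of_set B b \<noteq> 0" "fst x = h b"
    unfolding marking_def by (elim mimage_neq_0D) auto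
  then have "fst x \<in> places N"
    using assms(2) hom by (auto simp: mset_of_set_def net_hom_def split: if_splits)
  then have "num_colors (marking \<theta> B) (fst x) \<le> 1" using assms by (auto simp: safe_def)
  moreover have "marking \<theta> B x \<le> num_colors (marking \<theta> B) (fst x)"
    unfolding num_colors_def by (rule le_mimage)
  ultimately show False using inf by simp
qed

text \<open>Induction on \<open>C\<close>, removing a maximal event and firing it last. The
  assignment \<theta> is fixed throughout and replaces the absence of color conflict, so its local
  formulas pass directly to the smaller set.\<close>

lemma marking_reachable:
  assumes "safe N" "finite C" "C \<subseteq> transitions U"
    and "\<forall>e\<in>C. \<forall>e'\<in>transitions U. causal_le U e' e \<longrightarrow> e' \<in> C"
    and "\<forall>e\<in>C. \<forall>e'\<in>C. \<not> conflict U e e'"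
    and "phi_bot U \<theta>" "\<forall>e\<in>C. phi_loc U e \<theta>"
  shows "reachable N (marking \<theta> (Cut U C))"
  using assms(2-5,7)
proof (induction C rule: finite_psubset_induct)
  case (psubset C)
  show ?case
  proof (cases "C = {}")
    case True
    then have "Cut U C = initial_conditions U" by (auto simp: Cut_def)
    then show ?thesis using marking_initial[OF assms(6)] by (auto intro: reachable.init)
  next
    case False
    then obtain e where e: "e \<in> C" and max: "\<And>e'. e' \<in> C \<Longrightarrow> \<not> causal_less U e e'"
      using maximal_event[OF psubset.hyps] by blast
    define C' where "C' = C - {e}"
    have eT: "e \<in> transitions U" using e psubset.prems by blast
    \<comment> \<open>Maximality of \<open>e\<close> keeps the set causally closed after the
      removal: \<open>e\<close> lies below no other event of \<open>C\<close>.\<close>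
    have down: "\<forall>d\<in>C'. \<forall>d'\<in>transitions U. causal_le U d' d \<longrightarrow> d' \<in> C'"
    proof (intro ballI impI)
      fix d d' assume d: "d \<in> C'" "d' \<in> transitions U" "causal_le U d' d"
      then have "d' \<in> C" using psubset.prems by (auto simp: C'_def)
      moreover have "d' \<noteq> e"
        using d max[of d] by (auto simp: C'_def dest: rtranclpD)
      ultimately show "d' \<in> C'" by (simp add: C'_def)
    qed
    have reach: "reachable N (marking \<theta> (Cut U C'))"
    proof (rule psubset.IH)
      show "C' \<subset> C" using e by (auto simp: C'_def)
      then show "C' \<subseteq> transitions U" "\<forall>d\<in>C'. \<forall>d'\<in>C'. \<not> conflict U d d'"
        "\<forall>d\<in>C'. phi_loc U d \<theta>"
        using psubset.prems by blast+
    qed (rule down)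
    let ?pre = "{b. arc U b e}" and ?post = "{b. arc U e b}"
    \<comment> \<open>No other event of \<open>C\<close> consumes an input of \<open>e\<close>, as
      the two would be in conflict; the producer of such an input is in \<open>C\<close> by closure
      and differs from \<open>e\<close> by irreflexivity.\<close>
    have pre: "?pre \<subseteq> Cut U C'"
    proof
      fix b assume "b \<in> ?pre"
      then have arc: "arc U b e" by simp
      then have b: "b \<in> places U" using arc_cases eT place_not_transition by blast
      have "\<not> arc U b e''" if "e'' \<in> C'" for e''
      proof
        assume arc'': "arc U b e''"
        have e'': "e'' \<in> C" "e'' \<noteq> e" using that by (auto simp: C'_def)
        then have "e'' \<in> transitions U" using psubset.prems(1) by blast
        then have "conflict U e e''" using b arc arc'' eT e''(2)
          unfolding conflict_def by (metis rtranclp.rtrancl_refl)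
        then show False using psubset.prems(3) e e''(1) by blast
      qed
      moreover have "b \<in> initial_conditions U \<or> cond_event U b \<in> Some ` C'"
        using b
      proof (cases rule: place_cases)
        case (produced e' v)
        then have arc': "arc U e' b" by (auto simp: arc_def Suc_le_eq)
        then have less: "causal_less U e' e" using arc by (meson tranclp.simps)
        then have "e' \<in> C" using psubset.prems(2) e produced(1) tranclp_into_rtranclp by metis
        moreover have "e' \<noteq> e" using less causal_less_irrefl by blast
        ultimately have "e' \<in> C'" by (simp add: C'_def)
        then show ?thesis using cond_event_produced[OF arc' b] by simp
      qed auto
      ultimately show "b \<in> Cut U C'" using b by (auto simp: Cut_def)
    qed
    have post_event: "b \<in> places U \<and> cond_event U b = Some e" if "arc U e b" for b
      using that eT arc_cases place_not_transition cond_event_produced by blast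
    \<comment> \<open>On the level of conditions, adding \<open>e\<close> exchanges its preset for
      its postset, just as firing does with tokens.\<close>
    have Cut: "Cut U C = (Cut U C' - ?pre) \<union> ?post"
    proof
      show "Cut U C \<subseteq> (Cut U C' - ?pre) \<union> ?post"
      proof
        fix b assume b: "b \<in> Cut U C"
        show "b \<in> (Cut U C' - ?pre) \<union> ?post"
        proof (cases "cond_event U b = Some e")
          case True
          moreover have "b \<in> places U" using b Cut_subset_places by blast
          ultimately obtain v where "flow U e v b \<noteq> 0" using cond_event_eq_Some by metis
          then have "arc U e b" by (auto simp: arc_def Suc_le_eq)
          then show ?thesis by simp
        next
          case False
          then show ?thesis using b e by (auto simp: Cut_def C'_def)
        qed
      qed
      have "?post \<subseteq> Cut U C" using postset_in_Cut[OF psubset.prems(1) e max] by blast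
      then show "(Cut U C' - ?pre) \<union> ?post \<subseteq> Cut U C" by (auto simp: Cut_def C'_def)
    qed
    \<comment> \<open>Outputs of \<open>e\<close> are produced by \<open>e\<close> alone, which is
      not in \<open>C'\<close>.\<close>
    have disj: "(Cut U C' - ?pre) \<inter> ?post = {}"
      using post_event initial_condition_no_input by (fastforce simp: Cut_def C'_def)
    let ?\<sigma> = "\<lambda>v. \<theta> (Var v, Some e)"
    have loc: "phi_loc U e \<theta>" using psubset.prems e by blast
    have split: "marking \<theta> (Cut U C') x = marking \<theta> ?pre x + marking \<theta> (Cut U C' - ?pre) x" for x
    proof -
      have "Cut U C' = ?pre \<union> (Cut U C' - ?pre)" using pre by blast
      then show ?thesis unfolding marking_def
        by (metis (no_types, lifting) Diff_disjoint mimage_mset_of_set_Un)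
    qed
    \<comment> \<open>The preset part is a summand of a finite multiplicity; this licenses the
      cancellation below.\<close>
    have fin: "marking \<theta> ?pre x \<noteq> \<infinity>" for x
      using reachable_finite[OF assms(1) Cut_subset_places reach, of x] split[of x]
      by (metis plus_enat_simps(2))
    have "reachable N (\<lambda>x. (marking \<theta> (Cut U C') x - pre_inst N (h e) ?\<sigma> x) + post_inst N (h e) ?\<sigma> x)"
    proof (rule reachable.fire[OF reach])
      show "h e \<in> transitions N" using hom eT by (auto simp: net_hom_def)
      have "guard U e = guard N (h e)" using hom eT by (simp add: net_hom_def)
      then show "guard N (h e) ?\<sigma>" using loc by (simp add: phi_loc_def)
      show "\<forall>x. pre_inst N (h e) ?\<sigma> x \<le> marking \<theta> (Cut U C') x"
        by (simp add: pre_inst_eq[OF eT loc] split)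
    qed
    moreover have "(\<lambda>x. (marking \<theta> (Cut U C') x - pre_inst N (h e) ?\<sigma> x) + post_inst N (h e) ?\<sigma> x)
        = marking \<theta> (Cut U C)"
    proof
      fix x
      have "marking \<theta> (Cut U C') x - marking \<theta> ?pre x = marking \<theta> (Cut U C' - ?pre) x"
        using fin[of x] by (simp add: split)
      moreover have "marking \<theta> (Cut U C) x = marking \<theta> (Cut U C' - ?pre) x + marking \<theta> ?post x"
        unfolding Cut marking_def by (rule mimage_mset_of_set_Un[OF disj])
      ultimately show "(marking \<theta> (Cut U C') x - pre_inst N (h e) ?\<sigma> x) + post_inst N (h e) ?\<sigma> x
          = marking \<theta> (Cut U C) x"
        by (simp add: pre_inst_eq[OF eT loc] post_inst_eq[OF eT])
    qed
    ultimately show ?thesis by simp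
  qed
qed

section \<open>Injectivity of the labelling on cuts\<close>

lemma phi_bot_satisfiable: "\<exists>\<theta>. phi_bot U \<theta>"
proof -
  obtain K where K: "K \<in> initial U" using occ by (auto simp: occurrence_net_def is_hlnet_def)
  have "c = c'" if "K (b, c) \<noteq> 0" "K (b, c') \<noteq> 0" for b c c'
  proof (rule ccontr)
    assume "c \<noteq> c'"
    have "num_colors K b = 1"
      using initial_condition_marked[OF K that(1)] K
      by (auto simp: initial_conditions_def initial_condition_def)
    moreover have "sum K {(b, c), (b, c')} \<le> num_colors K b"
      unfolding num_colors_def by (rule sum_le_mimage) auto
    \<comment> \<open>Two distinct colors on \<open>b\<close> would count as two tokens, against the
      single one an initial condition carries.\<close>
    ultimately have "K (b, c) + K (b, c') \<le> 1" using \<open>c \<noteq> c'\<close> by simp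
    moreover have "1 \<le> K (b, c)" "1 \<le> K (b, c')" using that by (auto simp: ileI1 one_eSuc)
    ultimately have "(1 :: enat) + 1 \<le> 1" by (meson add_mono order_trans)
    then show False by (simp add: one_enat_def)
  qed
  \<comment> \<open>The witness reads the color of each initial condition off \<open>K\<close>; the
    value at proper variables is arbitrary, since \<open>phi_bot\<close> does not read it.\<close>
  then have "phi_bot U (\<lambda>(x, _). case x of Fresh b \<Rightarrow> SOME c. K (b, c) \<noteq> 0 | Var v \<Rightarrow> undefined)"
    using K unfolding phi_bot_def by (auto intro!: bexI[of _ K] some_equality)
  then show ?thesis by blast
qed

text \<open>Two conditions of the cut with one label would put two tokens on one place in a
  reachable marking.\<close>

lemma inj_on_Cut:
  assumes "safe N" "finite C" "configuration U C"
  shows "inj_on h (Cut U C)"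
proof (rule inj_onI, rule ccontr)
  obtain \<theta> where \<theta>: "phi_bot U \<theta>" "\<forall>e\<in>C. phi_loc U e \<theta>"
  \<comment> \<open>For the empty set, absence of color conflict is an empty conjunction and does
    not yield \<open>phi_bot\<close>, which is therefore supplied separately.\<close>
  proof (cases "C = {}")
    case True
    then show ?thesis using phi_bot_satisfiable that by blast
  next
    case False
    obtain \<theta> where "\<forall>e\<in>C. phi U (Some e) \<theta>"
      using assms(3) unfolding configuration_def color_conflict_def by blast
    then show ?thesis using False assms(3) that[of \<theta>] unfolding configuration_def by auto
  qed
  have reach: "reachable N (marking \<theta> (Cut U C))"
    using assms \<theta> by (intro marking_reachable) (auto simp: configuration_def)
  fix b b' assume b: "b \<in> Cut U C" "b' \<in> Cut U C" "h b = h b'" "b \<noteq> b'"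
  then have "h b \<in> places N" using Cut_subset_places hom by (auto simp: net_hom_def)
  then have "num_colors (marking \<theta> (Cut U C)) (h b) \<le> 1" using assms(1) reach by (auto simp: safe_def)
  \<comment> \<open>Forgetting colors leaves the image of the cut under \<open>h\<close>, whatever
    \<theta> is.\<close>
  moreover have "num_colors (marking \<theta> (Cut U C)) = mimage h (mset_of_set (Cut U C))"
    by (simp add: num_colors_def marking_def mimage_mimage)
  moreover have "sum (mset_of_set (Cut U C)) {b, b'} \<le> mimage h (mset_of_set (Cut U C)) (h b)"
    using b by (intro sum_le_mimage) auto
  moreover have "sum (mset_of_set (Cut U C)) {b, b'} = 1 + 1"
    using b by (simp add: mset_of_set_def)
  ultimately have "(1 :: enat) + 1 \<le> 1" by (metis order_trans)
  then show False by (simp add: one_enat_def)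
qed

text \<open>
  Every event of \<open>C\<close> lies below a maximal one, which has a condition of the cut in its postset.
\<close>

lemma Cut_phi_imp_phi:
  assumes "\<forall>t\<in>transitions N. \<exists>p v. postset N t (p, v) \<noteq> 0"
    and "finite C" "configuration U C" "\<forall>b\<in>Cut U C. phi U (cond_event U b) \<theta>"
  shows "phi_bot U \<theta>" "\<forall>e\<in>C. phi_loc U e \<theta>"
proof -
  have CT: "C \<subseteq> transitions U" using assms by (simp add: configuration_def)
  have above: "\<exists>e'. causal_le U e e' \<and> phi U (Some e') \<theta>" if e: "e \<in> C" for e
  proof -
    obtain e' where e': "e' \<in> C" "causal_le U e e'" "\<And>e''. e'' \<in> C \<Longrightarrow> \<not> causal_less U e' e''"
      using maximal_event_above[OF assms(2) e] by blast
    then have T: "e' \<in> transitions U" using CT by blast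
    obtain p v where "postset N (h e') (p, v) \<noteq> 0"
      using assms(1) hom T unfolding net_hom_def by (meson image_subset_iff)
    \<comment> \<open>An entry of the postset of \<open>h e'\<close> is pulled back along the
      homomorphism to an output condition of \<open>e'\<close>; maximality of \<open>e'\<close>
      places it in the cut.\<close>
    then have "mimage (\<lambda>(p, v). (h p, v)) (postset U e') (p, v) \<noteq> 0"
      using hom T by (simp add: net_hom_def)
    then obtain b v where "flow U e' v b \<noteq> 0"
      by (elim mimage_neq_0D) (auto simp: postset_def zero_enat_def)
    then have arc: "arc U e' b" by (auto simp: arc_def Suc_le_eq)
    then have "b \<in> Cut U C" using postset_in_Cut CT e' by blast
    moreover from this have "cond_event U b = Some e'"
      using cond_event_produced[OF arc] Cut_subset_places by blast
    ultimately show ?thesis using assms(4) e'(2) by fastforce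
  qed
  show "\<forall>e\<in>C. phi_loc U e \<theta>" using above CT by fastforce
  show "phi_bot U \<theta>"
  proof (cases "C = {}")
    case False
    then show ?thesis using above by fastforce
  next
    case True
    then have Cut: "Cut U C = initial_conditions U" by (auto simp: Cut_def)
    show ?thesis
    \<comment> \<open>Without initial conditions the cut is empty and imposes nothing, but then the
      initial cuts carry no tokens and \<open>phi_bot\<close> holds vacuously.\<close>
    proof (cases "initial_conditions U = {}")
      case True
      obtain K where "K \<in> initial U" using occ by (auto simp: occurrence_net_def is_hlnet_def)
      then show ?thesis using True initial_condition_marked unfolding phi_bot_def by blast
    next
      case False
      then show ?thesis using Cut assms(4) cond_event_initial by force
    qed
  qed
qed

section \<open>Markings as graphs and as solutions of constraints\<close>

lemma markings_of_eq: "markings_of U h C = {marking \<theta> (Cut U C) | \<theta>. \<theta> \<in> Inst U C}"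
  by (simp add: markings_of_def marking_def)

lemma Inst_phi_Cut:
  assumes "\<theta> \<in> Inst U C" "b \<in> Cut U C"
  shows "phi U (cond_event U b) \<theta>"
  using assms cond_event_initial by (auto simp: Inst_def Cut_def)

lemma marking_eq_graph:
  assumes "inj_on h B" "\<And>b. b \<in> B \<Longrightarrow> a (h b) = \<theta> (cond_ivar U b)"
  shows "marking \<theta> B = mset_of_set ((\<lambda>p. (p, a p)) ` h ` B)"
proof -
  have "marking \<theta> B = mimage (\<lambda>b. (h b, a (h b))) (mset_of_set B)"
    unfolding marking_def using assms(2)
    by (intro mimage_cong) (auto simp: mset_of_set_def split: if_splits)
  also have "\<dots> = mset_of_set ((\<lambda>p. (p, a p)) ` h ` B)"
    using assms(1) by (subst mimage_mset_of_set_inj) (auto simp: inj_on_def image_image)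
  finally show ?thesis .
qed

text \<open>From left to right, a witness of the constraint satisfies all formulas of
  \<open>C\<close> by \<open>Cut_phi_imp_phi\<close> and restricts to an instantiation. Conversely,
  equality of the two multisets forces \<open>a\<close> to agree with the instantiation on every cut
  label.\<close>

lemma constr_iff_marking:
  assumes "safe N" "\<forall>t\<in>transitions N. \<exists>p v. postset N t (p, v) \<noteq> 0"
    and "finite C" "configuration U C"
  shows "constr U h (Cut U C) a \<longleftrightarrow> mset_of_set ((\<lambda>p. (p, a p)) ` h ` Cut U C) \<in> markings_of U h C"
    (is "_ \<longleftrightarrow> ?M \<in> _")
proof
  assume "constr U h (Cut U C) a"
  then obtain \<theta> where \<theta>: "\<forall>b\<in>Cut U C. phi U (cond_event U b) \<theta>"
    and a: "\<And>b. b \<in> Cut U C \<Longrightarrow> a (h b) = \<theta> (cond_ivar U b)"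
    unfolding constr_def psi_def by blast
  let ?\<theta> = "restrict \<theta> (config_ivars U C)"
  have "?\<theta> \<in> Inst U C"
    using restrict_in_Inst Cut_phi_imp_phi assms \<theta> by blast
  moreover have "marking ?\<theta> (Cut U C) = ?M"
    using assms a Cut_cond_ivar by (intro marking_eq_graph inj_on_Cut) auto
  ultimately show "?M \<in> markings_of U h C" unfolding markings_of_eq by (metis (mono_tags, lifting) mem_Collect_eq)
next
  assume "?M \<in> markings_of U h C"
  then obtain \<theta> where \<theta>: "\<theta> \<in> Inst U C" and M: "?M = marking \<theta> (Cut U C)"
    unfolding markings_of_eq by blast
  have "a (h b) = \<theta> (cond_ivar U b)" if "b \<in> Cut U C" for b
  proof -
    \<comment> \<open>The token of \<open>b\<close> has positive multiplicity in the marking, so it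
      lies on the graph of \<open>a\<close>.\<close>
    have "mset_of_set (Cut U C) b \<le> ?M (h b, \<theta> (cond_ivar U b))"
      unfolding M marking_def using le_mimage[of "mset_of_set (Cut U C)" b "\<lambda>b. (h b, \<theta> (cond_ivar U b))"]
      by simp
    then show ?thesis using that by (auto simp: mset_of_set_def split: if_splits)
  qed
  then show "constr U h (Cut U C) a"
    using Inst_phi_Cut[OF \<theta>] unfolding constr_def psi_def by blast
qed

lemma markings_of_graph:
  assumes "safe N" "finite C" "configuration U C" "M \<in> markings_of U h C"
  obtains a where "M = mset_of_set ((\<lambda>p. (p, a p)) ` h ` Cut U C)"
proof -
  obtain \<theta> where M: "M = marking \<theta> (Cut U C)" using assms(4) unfolding markings_of_eq by blast
  have inj: "inj_on h (Cut U C)" using inj_on_Cut assms by blast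
  \<comment> \<open>The map \<open>a\<close> sends a label back to its unique condition in the cut
    and takes the color of that condition.\<close>
  have "M = mset_of_set ((\<lambda>p. (p, \<theta> (cond_ivar U (inv_into (Cut U C) h p)))) ` h ` Cut U C)"
    unfolding M using inj by (intro marking_eq_graph) (auto simp: inv_into_f_f)
  then show ?thesis by (rule that)
qed

end

theorem theorem2:
  fixes N :: "('n, 'v, 'c) hlnet"
    and U :: "('u, 'v, 'c) hlnet"
    and h :: "'u \<Rightarrow> 'n"
    and C :: "'u set"
    and Cs :: "nat \<Rightarrow> 'u set"
    and n :: nat
  assumes "is_hlnet N"
    and "safe N"
    and nonempty_postsets: "\<forall>t\<in>transitions N. \<exists>p v. postset N t (p, v) \<noteq> 0"
    and "symbolic_unfolding N U h"
    and "finite C" and "configuration U C"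
    and "\<forall>i\<in>{1..n}. finite (Cs i) \<and> configuration U (Cs i)"
    and "\<forall>i\<in>{1..n}. h ` Cut U C = h ` Cut U (Cs i)"
  shows "markings_of U h C \<subseteq> (\<Union>i\<in>{1..n}. markings_of U h (Cs i)) \<longleftrightarrow>
    (\<forall>a. constr U h (Cut U C) a \<longrightarrow> (\<exists>i\<in>{1..n}. constr U h (Cut U (Cs i)) a))"
proof -
  interpret branching_process N U h
    using assms(4)
    by unfold_locales (auto simp: symbolic_unfolding_def symbolic_branching_process_def)
  let ?M = "\<lambda>a. mset_of_set ((\<lambda>p. (p, a p)) ` h ` Cut U C)"
  have C: "constr U h (Cut U C) a \<longleftrightarrow> ?M a \<in> markings_of U h C" for a
    using constr_iff_marking assms(2,5,6) nonempty_postsets by blast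
  \<comment> \<open>Equal cut labels let the graph over the labels of \<open>C\<close> serve for
    every \<open>Cs i\<close>.\<close>
  have Cs: "constr U h (Cut U (Cs i)) a \<longleftrightarrow> ?M a \<in> markings_of U h (Cs i)" if "i \<in> {1..n}" for i a
    using constr_iff_marking[OF assms(2) nonempty_postsets, of "Cs i"] assms(7,8) that by simp
  have graph: "\<exists>a. M = ?M a" if "M \<in> markings_of U h C" for M
    using markings_of_graph[OF assms(2,5,6) that] by metis
  show ?thesis
  proof
    assume sub: "markings_of U h C \<subseteq> (\<Union>i\<in>{1..n}. markings_of U h (Cs i))"
    show "\<forall>a. constr U h (Cut U C) a \<longrightarrow> (\<exists>i\<in>{1..n}. constr U h (Cut U (Cs i)) a)"
    proof (intro allI impI)
      fix a assume "constr U h (Cut U C) a"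
      then have "?M a \<in> (\<Union>i\<in>{1..n}. markings_of U h (Cs i))" using sub C by blast
      then obtain i where "i \<in> {1..n}" "?M a \<in> markings_of U h (Cs i)" by blast
      then show "\<exists>i\<in>{1..n}. constr U h (Cut U (Cs i)) a" using Cs by blast
    qed
  next
    assume imp: "\<forall>a. constr U h (Cut U C) a \<longrightarrow> (\<exists>i\<in>{1..n}. constr U h (Cut U (Cs i)) a)"
    show "markings_of U h C \<subseteq> (\<Union>i\<in>{1..n}. markings_of U h (Cs i))"
    proof
      fix M assume M: "M \<in> markings_of U h C"
      then obtain a where a: "M = ?M a" using graph by blast
      then have "constr U h (Cut U C) a" using C M by simp
      then obtain i where "i \<in> {1..n}" "constr U h (Cut U (Cs i)) a" using imp by blast
      then show "M \<in> (\<Union>i\<in>{1..n}. markings_of U h (Cs i))" using Cs a by blast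
    qed
  qed
qed

end
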